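(* Let $p=2r$ with $r\ge1$ an integer. Let $\{\mu_m\}_{m\ge 0}$ be a sequence of real-valued functions in $L^p[0,1]$, let $\{c_m\}_{m\ge0}$ be a sequence of real numbers, and let $\{\alpha_n\}_{n\ge0}$ be a strictly increasing sequence of non-negative integers. For $n\ge0$ let $$G_n(t)=\sum_{0\le m<\alpha_n}c_m\mu_m(t),\qquad G_{-1}(t)=0,\qquad g_n(t)=G_n(t)-G_{n-1}(t).$$ Assume: (1) (Type III superorthogonality) $\int_0^1 g_{n_1}(t)g_{n_2}(t)\cdots g_{n_{2r}}(t)\,dt=0$ whenever $n_1>\max\{n_2,\dots,n_{2r}\}$; (2) there is a constant $A_p$ such that for all $N\ge0$, $\big\|\sup_{0\le n\le N}|G_{n-1}|\big\|_{L^p[0,1]}\le A_p\|G_N\|_{L^p[0,1]}$; (3) there is a constant $B_p$ such that for all $N\ge0$, $\big\|(\sum_{n=0}^N g_n^p)^{1/p}\big\|_{L^p[0,1]}\le B_p\|G_N\|_{L^p[0,1]}$. Then there are constants $C,C'$, depending only on $p$, $A_p$ and $B_p$, such that for all $N\ge0$, $$C'\,\Big\|\Big(\sum_{n=0}^N g_n^2\Big)^{1/2}\Big\|_{L^p[0,1]}\le\Big\|\sum_{n=0}^N g_n\Big\|_{L^p[0,1]}\le C\,\Big\|\Big(\sum_{n=0}^N g_n^2\Big)^{1/2}\Big\|_{L^p[0,1]},\qquad C'>0 .$$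
   Context: The interval $[0,1]$ carries Lebesgue measure. Note that $\sum_{n=0}^N g_n=G_N$. *)

theory Defs
  imports "HOL-Analysis.Analysis"
begin

abbreviation unit_leb :: "real measure" where
  "unit_leb \<equiv> lebesgue_on {0..1}"

definition in_Lp :: "nat \<Rightarrow> (real \<Rightarrow> real) \<Rightarrow> bool" where
  "in_Lp p f \<longleftrightarrow> f \<in> borel_measurable unit_leb \<and> integrable unit_leb (\<lambda>t. \<bar>f t\<bar> ^ p)"

text \<open>The Bochner integral of a non-integrable function is 0, so this is the
  \<open>L\<^sup>p\<close> norm only for functions satisfying \<^const>\<open>in_Lp\<close>.\<close>

definition Lp_norm :: "nat \<Rightarrow> (real \<Rightarrow> real) \<Rightarrow> real" where
  "Lp_norm p f = root p (LINT t|unit_leb. \<bar>f t\<bar> ^ p)"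

text \<open>The index is an integer in order to allow \<open>G\<close> at \<open>-1\<close>, where it vanishes.\<close>

definition partial_G ::
  "(nat \<Rightarrow> real \<Rightarrow> real) \<Rightarrow> (nat \<Rightarrow> real) \<Rightarrow> (nat \<Rightarrow> nat) \<Rightarrow> int \<Rightarrow> real \<Rightarrow> real" where
  "partial_G \<mu> c \<alpha> n t = (if n < 0 then 0 else \<Sum>m<\<alpha> (nat n). c m * \<mu> m t)"

definition diff_g ::
  "(nat \<Rightarrow> real \<Rightarrow> real) \<Rightarrow> (nat \<Rightarrow> real) \<Rightarrow> (nat \<Rightarrow> nat) \<Rightarrow> nat \<Rightarrow> real \<Rightarrow> real" where
  "diff_g \<mu> c \<alpha> n t = partial_G \<mu> c \<alpha> (int n) t - partial_G \<mu> c \<alpha> (int n - 1) t"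

text \<open>Type III superorthogonality of \<open>2r\<close>-tuples; the tuple is \<open>k 1, \<dots>, k (2r)\<close>.\<close>

definition superorthogonal_III :: "nat \<Rightarrow> (nat \<Rightarrow> real \<Rightarrow> real) \<Rightarrow> bool" where
  "superorthogonal_III r g \<longleftrightarrow>
     (\<forall>k :: nat \<Rightarrow> nat. k 1 > Max (k ` {2..2 * r}) \<longrightarrow>
        (LINT t|unit_leb. (\<Prod>i = 1..2 * r. g (k i) t)) = 0)"

end

(*
  Write S for the square function of g_0, ..., g_N. For the upper bound, telescope
  G_n^p - G_{n-1}^p: the linear term p g_n G_{n-1}^{p-1} has integral zero by
  superorthogonality, and the remainder is at most a constant times
  g_n^2 (sup |G_{n-1}| + S)^{p-2}. For the lower bound, telescope the p-th power of the
  partial square functions: the linear term is r g_n^2 S_{n-1}^{p-2}, where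
  g_n^2 = G_n^2 - G_{n-1}^2 - 2 g_n G_{n-1}; the last summand again integrates to zero,
  the others are at most G_N^2 S^{p-2} by Abel summation, and the remainder is at most a
  constant times D^2 S^{p-2} with D = (sum g_n^p)^{1/p}. Both times a pointwise Young
  inequality absorbs what is not controlled, using (2) and (3) respectively.
*)

theory Submission
  imports Defs
begin

section \<open>Elementary inequalities for real powers\<close>

text \<open>Second-order Taylor estimate with the constant doubled, which makes a bare induction
  work: the remainders satisfy R_(n+1) = (a + b) R_n + n b^2 a^(n-1), and n (n - 1) + n = n^2 is at
  most (n + 1) n. Only the two endpoints need the bound \<open>m\<close>.\<close>

lemma power_taylor_bound:
  fixes a b m :: real
  assumes "\<bar>a\<bar> \<le> m" and "\<bar>a + b\<bar> \<le> m"
  shows "\<bar>(a + b) ^ n - a ^ n - real n * b * a ^ (n - 1)\<bar>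
           \<le> real n * (real n - 1) * b\<^sup>2 * m ^ (n - 2)"
proof (induction n)
  case 0
  then show ?case by simp
next
  case (Suc n)
  have m0: "0 \<le> m" using assms by linarith
  let ?R = "(a + b) ^ n - a ^ n - real n * b * a ^ (n - 1)"
  \<comment> \<open>The exponent \<open>n - 2\<close> is truncated for small \<open>n\<close>, so m
    * m^(n-2) = m^(n-1) is available only from n = 2 on.\<close>
  consider "n = 0" | "n = 1" | k where "n = Suc (Suc k)"
    by (metis One_nat_def not0_implies_Suc)
  then show ?case
  proof cases
    case 1
    then show ?thesis by simp
  next
    case 2
    have "(a + b) ^ 2 - a ^ 2 - 2 * b * a = b\<^sup>2"
      by (simp add: power2_eq_square algebra_simps)
    then show ?thesis using 2 by (simp add: numeral_2_eq_2)
  next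
    case 3
    have eq: "(a + b) ^ Suc n - a ^ Suc n - real (Suc n) * b * a ^ (Suc n - 1)
          = (a + b) * ?R + real n * b\<^sup>2 * a ^ (n - 1)"
      using 3 by (simp add: algebra_simps power2_eq_square)
    have "\<bar>(a + b) * ?R\<bar> \<le> m * (real n * (real n - 1) * b\<^sup>2 * m ^ (n - 2))"
      unfolding abs_mult using Suc assms m0 by (intro mult_mono) auto
    also have "\<dots> = real n * (real n - 1) * b\<^sup>2 * m ^ (n - 1)"
      using 3 by simp
    finally have 1: "\<bar>(a + b) * ?R\<bar> \<le> real n * (real n - 1) * b\<^sup>2 * m ^ (n - 1)" .
    have "\<bar>a ^ (n - 1)\<bar> \<le> m ^ (n - 1)"
      using assms by (simp add: power_abs power_mono)
    then have 2: "\<bar>real n * b\<^sup>2 * a ^ (n - 1)\<bar> \<le> real n * b\<^sup>2 * m ^ (n - 1)"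
      by (simp add: abs_mult mult_left_mono)
    have "real n * b\<^sup>2 * m ^ (n - 1) \<ge> 0" using m0 by simp
    then have "real n * (real n - 1) * b\<^sup>2 * m ^ (n - 1) + real n * b\<^sup>2 * m ^ (n - 1)
        \<le> real (Suc n) * (real (Suc n) - 1) * b\<^sup>2 * m ^ (Suc n - 2)"
      using 3 by (simp add: algebra_simps)
    with 1 2 show ?thesis unfolding eq by linarith
  qed
qed

text \<open>A dichotomy replaces the weighted arithmetic-geometric mean inequality. If x is at most
  \<epsilon> y, then x^j contributes \<epsilon>^j, which is at most \<epsilon> because j is at least
  1. Otherwise y is below x / \<epsilon> and everything is charged to x^p. The constant is far from
  optimal, but only the small factor of y^p matters for absorption.\<close>

lemma young_power:
  fixes x y \<epsilon> :: real
  assumes "0 < \<epsilon>" "\<epsilon> \<le> 1" "0 \<le> x" "0 \<le> y" "1 \<le> j" "j \<le> p"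
  shows "x ^ j * y ^ (p - j) \<le> \<epsilon> * y ^ p + (1 / \<epsilon>) ^ p * x ^ p"
proof (cases "x \<le> \<epsilon> * y")
  case True
  have "x ^ j * y ^ (p - j) \<le> (\<epsilon> * y) ^ j * y ^ (p - j)"
    using True assms by (intro mult_right_mono power_mono) auto
  also have "\<dots> = \<epsilon> ^ j * y ^ p"
    using assms by (simp add: power_mult_distrib mult.assoc flip: power_add)
  also have "\<dots> \<le> \<epsilon> * y ^ p"
    using assms power_decreasing[of 1 j \<epsilon>] by (intro mult_right_mono) auto
  finally show ?thesis using assms by (simp add: add_increasing2)
next
  case False
  have "y \<le> 1 / \<epsilon> * x" using False assms by (simp add: field_simps)
  then have "x ^ j * y ^ (p - j) \<le> x ^ j * (1 / \<epsilon> * x) ^ (p - j)"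
    using assms by (intro mult_left_mono power_mono) auto
  also have "\<dots> = (1 / \<epsilon>) ^ (p - j) * x ^ p"
  proof -
    have "x ^ j * x ^ (p - j) = x ^ p" using assms by (simp flip: power_add)
    then show ?thesis by (metis mult.left_commute power_mult_distrib)
  qed
  also have "\<dots> \<le> (1 / \<epsilon>) ^ p * x ^ p"
    using assms by (intro mult_right_mono power_increasing) auto
  finally show ?thesis using assms by (simp add: add_increasing)
qed

lemma power_add_le:
  fixes x y :: real
  assumes "0 \<le> x" "0 \<le> y"
  shows "(x + y) ^ p \<le> 2 ^ p * (x ^ p + y ^ p)"
proof -
  have "(x + y) ^ p \<le> (2 * max x y) ^ p"
    using assms by (intro power_mono) auto
  also have "\<dots> = 2 ^ p * (max x y) ^ p" by (simp add: power_mult_distrib)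
  also have "\<dots> \<le> 2 ^ p * (x ^ p + y ^ p)"
    using assms by (intro mult_left_mono) (auto simp: max_def)
  finally show ?thesis .
qed

section \<open>Closure properties of L^p and conversion between norms and p-th power
  integrals\<close>

lemma in_Lp_dominated:
  assumes "in_Lp p h" and "f \<in> borel_measurable unit_leb" and "\<And>t. \<bar>f t\<bar> \<le> \<bar>h t\<bar>"
  shows "in_Lp p f"
proof -
  have "integrable unit_leb (\<lambda>t. \<bar>f t\<bar> ^ p)"
    by (rule Bochner_Integration.integrable_bound[of _ "\<lambda>t. \<bar>h t\<bar> ^ p"])
      (use assms in \<open>auto simp: in_Lp_def power_mono\<close>)
  with assms show ?thesis by (simp add: in_Lp_def)
qed

lemma in_Lp_add:
  assumes "in_Lp p f" "in_Lp p h"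
  shows "in_Lp p (\<lambda>t. f t + h t)"
proof -
  have [measurable]: "f \<in> borel_measurable unit_leb" "h \<in> borel_measurable unit_leb"
    using assms by (auto simp: in_Lp_def)
  have le: "\<bar>f t + h t\<bar> ^ p \<le> 2 ^ p * (\<bar>f t\<bar> ^ p + \<bar>h t\<bar> ^ p)" for t
    by (rule order_trans[OF power_mono power_add_le]) auto
  have "integrable unit_leb (\<lambda>t. \<bar>f t + h t\<bar> ^ p)"
  proof (rule Bochner_Integration.integrable_bound)
    show "integrable unit_leb (\<lambda>t. 2 ^ p * (\<bar>f t\<bar> ^ p + \<bar>h t\<bar> ^ p))"
      using assms by (auto simp: in_Lp_def)
    show "AE t in unit_leb. norm (\<bar>f t + h t\<bar> ^ p)
        \<le> norm (2 ^ p * (\<bar>f t\<bar> ^ p + \<bar>h t\<bar> ^ p))"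
      by (rule AE_I2, unfold real_norm_def, rule order_trans[OF _ abs_ge_self])
        (use le in simp)
  qed measurable
  then show ?thesis by (simp add: in_Lp_def)
qed

lemma in_Lp_zero: "p > 0 \<Longrightarrow> in_Lp p (\<lambda>t. 0)"
  by (simp add: in_Lp_def)

lemma in_Lp_sum:
  assumes "p > 0" "finite I" "\<And>i. i \<in> I \<Longrightarrow> in_Lp p (f i)"
  shows "in_Lp p (\<lambda>t. \<Sum>i\<in>I. f i t)"
  using assms(2,3) by (induction I rule: finite_induct) (auto intro: in_Lp_zero in_Lp_add assms(1))

lemma in_Lp_abs: "in_Lp p f \<Longrightarrow> in_Lp p (\<lambda>t. \<bar>f t\<bar>)"
  by (auto simp: in_Lp_def)

lemma in_Lp_cmult: "in_Lp p f \<Longrightarrow> in_Lp p (\<lambda>t. c * f t)"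
  by (auto simp: in_Lp_def abs_mult power_mult_distrib)

lemma Lp_norm_power:
  assumes "p > 0"
  shows "Lp_norm p f ^ p = (LINT t|unit_leb. \<bar>f t\<bar> ^ p)"
  unfolding Lp_norm_def using assms by (intro real_root_pow_pos2) auto

lemma Lp_norm_nonneg: "p > 0 \<Longrightarrow> 0 \<le> Lp_norm p f"
  by (auto simp: Lp_norm_def intro!: real_root_ge_zero integral_nonneg_AE)

text \<open>The constant in the hypothesis may be negative, and raising to the power p is monotone
  only on nonnegative numbers; hence the absolute value of \<open>A\<close>.\<close>

lemma integral_le_of_Lp_norm_le:
  assumes "p > 0" "Lp_norm p f \<le> A * Lp_norm p h"
  shows "(LINT t|unit_leb. \<bar>f t\<bar> ^ p) \<le> \<bar>A\<bar> ^ p * (LINT t|unit_leb. \<bar>h t\<bar> ^ p)"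
proof -
  have "Lp_norm p f \<le> \<bar>A\<bar> * Lp_norm p h"
    using assms Lp_norm_nonneg[of p h] by (meson abs_ge_self mult_right_mono order_trans)
  then have "Lp_norm p f ^ p \<le> (\<bar>A\<bar> * Lp_norm p h) ^ p"
    by (intro power_mono Lp_norm_nonneg assms)
  then show ?thesis using assms by (simp add: power_mult_distrib Lp_norm_power)
qed

lemma Lp_norm_le_of_integral_le:
  assumes "p > 0"
    and "(LINT t|unit_leb. \<bar>f t\<bar> ^ p) \<le> K * (LINT t|unit_leb. \<bar>h t\<bar> ^ p)"
  shows "Lp_norm p f \<le> root p K * Lp_norm p h"
  using assms unfolding Lp_norm_def by (simp flip: real_root_mult)

section \<open>Homogeneous polynomials in the earlier functions\<close>

text \<open>Type III superorthogonality makes g_n orthogonal to every such function of degree p - 1.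
  Closure under sums and products then replaces multinomial expansions of the powers of partial
  sums. Coefficients arise only by repeated addition, which suffices for these powers.\<close>

inductive homogeneous_poly ::
  "(nat \<Rightarrow> real \<Rightarrow> real) \<Rightarrow> nat \<Rightarrow> nat \<Rightarrow> (real \<Rightarrow> real) \<Rightarrow> bool"
  for g n where
  zero: "homogeneous_poly g n d (\<lambda>t. 0)"
| monomial: "set k \<subseteq> {..<n} \<Longrightarrow> homogeneous_poly g n (length k) (\<lambda>t. \<Prod>i\<leftarrow>k. g i t)"
| add: "homogeneous_poly g n d f \<Longrightarrow> homogeneous_poly g n d h \<Longrightarrow>
    homogeneous_poly g n d (\<lambda>t. f t + h t)"

lemma homogeneous_poly_sum:
  assumes "finite I" "\<And>i. i \<in> I \<Longrightarrow> homogeneous_poly g n d (f i)"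
  shows "homogeneous_poly g n d (\<lambda>t. \<Sum>i\<in>I. f i t)"
  using assms by (induction I rule: finite_induct)
    (auto intro: homogeneous_poly.zero homogeneous_poly.add)

lemma homogeneous_poly_mult:
  assumes "homogeneous_poly g n d f" "homogeneous_poly g n e h"
  shows "homogeneous_poly g n (d + e) (\<lambda>t. f t * h t)"
  using assms(1)
proof (induction rule: homogeneous_poly.induct)
  case (monomial k)
  from assms(2) show ?case
  proof (induction rule: homogeneous_poly.induct)
    case (monomial l)
    then show ?case
      using homogeneous_poly.monomial[of "k @ l" n g] \<open>set k \<subseteq> {..<n}\<close> by simp
  qed (auto intro: homogeneous_poly.zero homogeneous_poly.add simp: distrib_left)
qed (auto intro: homogeneous_poly.zero homogeneous_poly.add simp: distrib_right)

lemma homogeneous_poly_var: "m < n \<Longrightarrow> homogeneous_poly g n 1 (g m)"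
  using homogeneous_poly.monomial[of "[m]" n g] by simp

lemma homogeneous_poly_power:
  assumes "homogeneous_poly g n d f"
  shows "homogeneous_poly g n (d * e) (\<lambda>t. f t ^ e)"
proof (induction e)
  case 0
  then show ?case using homogeneous_poly.monomial[of "[]" n g] by simp
next
  case (Suc e)
  then show ?case using homogeneous_poly_mult[OF assms Suc] by simp
qed

lemma abs_prod_list_le:
  fixes m :: real
  assumes "\<And>i. i \<in> set k \<Longrightarrow> \<bar>f i\<bar> \<le> m"
  shows "\<bar>\<Prod>i\<leftarrow>k. f i\<bar> \<le> m ^ length k"
  using assms
proof (induction k)
  case (Cons a k)
  then have "\<bar>f a\<bar> * \<bar>\<Prod>i\<leftarrow>k. f i\<bar> \<le> m * m ^ length k"
    by (intro mult_mono) (auto intro: order_trans[OF abs_ge_zero])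
  then show ?case by (simp add: abs_mult)
qed simp

section \<open>Partial sums and square functions of a superorthogonal sequence\<close>

locale superorthogonal_sequence =
  fixes r p :: nat and g :: "nat \<Rightarrow> real \<Rightarrow> real"
  assumes r: "r \<ge> 1" and p: "p = 2 * r"
    and Lp: "in_Lp p (g n)"
    and superorthogonal: "superorthogonal_III r g"
begin

text \<open>The index is shifted: \<open>psum n\<close> is G_(n-1), so that it involves only
  functions earlier than g_n and vanishes at n = 0. Accordingly G_N is \<open>psum (Suc N)\<close>,
  and the full square function is the root of \<open>sqsum (Suc N)\<close>.\<close>

definition psum :: "nat \<Rightarrow> real \<Rightarrow> real" where
  "psum n t = (\<Sum>m<n. g m t)"

definition sqsum :: "nat \<Rightarrow> real \<Rightarrow> real" where
  "sqsum n t = (\<Sum>m<n. (g m t)\<^sup>2)"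

lemma p_pos: "p > 0" using r p by simp

lemma p_even: "even p" using p by simp

lemma abs_power_p: "\<bar>x :: real\<bar> ^ p = x ^ p"
  by (rule power_even_abs[OF p_even])

lemma measurable_g [measurable]: "g n \<in> borel_measurable unit_leb"
  using Lp by (auto simp: in_Lp_def)

lemma measurable_psum [measurable]: "psum n \<in> borel_measurable unit_leb"
  unfolding psum_def[abs_def] by measurable

lemma measurable_sqsum [measurable]: "sqsum n \<in> borel_measurable unit_leb"
  unfolding sqsum_def[abs_def] by measurable

lemma sqsum_nonneg: "0 \<le> sqsum n t"
  by (simp add: sqsum_def sum_nonneg)

lemma sqsum_mono: "m \<le> n \<Longrightarrow> sqsum m t \<le> sqsum n t"
  unfolding sqsum_def by (intro sum_mono2) auto

lemma psum_Suc: "psum (Suc n) t = psum n t + g n t"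
  by (simp add: psum_def)

lemma sqsum_Suc: "sqsum (Suc n) t = sqsum n t + (g n t)\<^sup>2"
  by (simp add: sqsum_def)

lemma abs_le_sqrt_sqsum: "m < n \<Longrightarrow> \<bar>g m t\<bar> \<le> sqrt (sqsum n t)"
  unfolding sqsum_def
  by (intro real_le_rsqrt) (auto intro: member_le_sum[of m _ "\<lambda>m. (g m t)\<^sup>2"])

section \<open>Orthogonality of g_n to polynomials in its predecessors\<close>

text \<open>Each factor is at most the sum of all the absolute values, which lies in L^p; this
  pointwise bound avoids the generalized Hoelder inequality.\<close>

lemma integrable_monomial:
  assumes "length k = p"
  shows "integrable unit_leb (\<lambda>t. \<Prod>i\<leftarrow>k. g i t)"
proof -
  have "in_Lp p (\<lambda>t. \<Sum>i\<in>set k. \<bar>g i t\<bar>)"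
    by (intro in_Lp_sum in_Lp_abs Lp p_pos) auto
  then have int: "integrable unit_leb (\<lambda>t. (\<Sum>i\<in>set k. \<bar>g i t\<bar>) ^ p)"
    by (simp add: in_Lp_def p_even)
  have "\<bar>\<Prod>i\<leftarrow>k. g i t\<bar> \<le> (\<Sum>i\<in>set k. \<bar>g i t\<bar>) ^ p" for t
    using abs_prod_list_le[of k "\<lambda>i. g i t" "\<Sum>i\<in>set k. \<bar>g i t\<bar>"] assms
      member_le_sum[of _ "set k" "\<lambda>i. \<bar>g i t\<bar>"] by simp
  moreover have "(\<lambda>t. \<Prod>i\<leftarrow>k. g i t) \<in> borel_measurable unit_leb"
    by (induction k) auto
  ultimately show ?thesis
    by (intro Bochner_Integration.integrable_bound[OF int]) (auto simp: sum_nonneg)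
qed

lemma integral_monomial:
  assumes "Suc (length k) = p" "set k \<subseteq> {..<n}"
  shows "(LINT t|unit_leb. g n t * (\<Prod>i\<leftarrow>k. g i t)) = 0"
proof -
  \<comment> \<open>Superorthogonality numbers its tuples from 1, lists are numbered from 0.
    Position 1 carries n, and positions 2 to 2r carry the entries of \<open>k\<close>, all below
    n.\<close>
  define \<kappa> where "\<kappa> i = (n # k) ! (i - 1)" for i
  have "Max (\<kappa> ` {2..2 * r}) < \<kappa> 1"
  proof (subst Max_less_iff)
    show "\<forall>a\<in>\<kappa> ` {2..2 * r}. a < \<kappa> 1"
    proof safe
      fix i assume i: "i \<in> {2..2 * r}"
      then obtain j where j: "i = Suc (Suc j)"
        by (metis atLeastAtMost_iff add_2_eq_Suc le_Suc_ex)
      with i assms p have "k ! j \<in> set k" by (intro nth_mem) auto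
      with assms show "\<kappa> i < \<kappa> 1" by (auto simp: \<kappa>_def j)
    qed
  qed (use r in auto)
  moreover have "g n t * (\<Prod>i\<leftarrow>k. g i t) = (\<Prod>i = 1..2 * r. g (\<kappa> i) t)" for t
  proof -
    have "g n t * (\<Prod>i\<leftarrow>k. g i t) = (\<Prod>i\<leftarrow>n # k. g i t)" by simp
    also have "\<dots> = (\<Prod>i = 0..<p. g ((n # k) ! i) t)"
      using assms by (subst prod.list_conv_set_nth) (simp del: list.map)
    also have "\<dots> = (\<Prod>i = 1..2 * r. g (\<kappa> i) t)"
      by (rule prod.reindex_bij_witness[of _ "\<lambda>i. i - 1" Suc]) (auto simp: \<kappa>_def p)
    finally show ?thesis .
  qed
  ultimately show ?thesis
    using superorthogonal by (simp add: superorthogonal_III_def)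
qed

text \<open>The form in which superorthogonality is applied. Integrability has to be proved in the
  same induction, since splitting the integral of a sum requires it.\<close>

lemma homogeneous_poly_orthogonal:
  assumes "homogeneous_poly g n (p - 1) f"
  shows "integrable unit_leb (\<lambda>t. g n t * f t)" and "(LINT t|unit_leb. g n t * f t) = 0"
proof -
  have "integrable unit_leb (\<lambda>t. g n t * f t) \<and> (LINT t|unit_leb. g n t * f t) = 0"
    if "homogeneous_poly g n d f" "Suc d = p" for d
    using that
  proof (induction rule: homogeneous_poly.induct)
    case (monomial k)
    then show ?case
      using integrable_monomial[of "n # k"] integral_monomial[of k n] by simp
  qed (auto simp: distrib_left)
  then show "integrable unit_leb (\<lambda>t. g n t * f t)" "(LINT t|unit_leb. g n t * f t) = 0"
    using assms p_pos by auto
qed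

lemma homogeneous_poly_psum: "homogeneous_poly g n 1 (psum n)"
  unfolding psum_def[abs_def]
  by (intro homogeneous_poly_sum homogeneous_poly_var) auto

lemma homogeneous_poly_sqsum: "homogeneous_poly g n 2 (sqsum n)"
  unfolding sqsum_def[abs_def]
  using homogeneous_poly_power[OF homogeneous_poly_var, of _ n g 2]
  by (intro homogeneous_poly_sum) auto

lemma homogeneous_poly_psum_power: "homogeneous_poly g n (p - 1) (\<lambda>t. psum n t ^ (p - 1))"
  using homogeneous_poly_power[OF homogeneous_poly_psum, of n "p - 1"] by simp

lemma homogeneous_poly_psum_sqsum:
  "homogeneous_poly g n (p - 1) (\<lambda>t. psum n t * sqsum n t ^ (r - 1))"
proof -
  have "1 + 2 * (r - 1) = p - 1" using r p by simp
  then show ?thesis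
    using homogeneous_poly_mult[OF homogeneous_poly_psum
        homogeneous_poly_power[OF homogeneous_poly_sqsum, of n "r - 1"]] by simp
qed

lemma sqrt_sqsum_power: "sqrt (sqsum n t) ^ p = sqsum n t ^ r"
  by (simp add: p power_mult sqsum_nonneg)

lemma in_Lp_psum: "in_Lp p (psum n)"
  unfolding psum_def[abs_def] by (intro in_Lp_sum Lp p_pos) auto

lemma in_Lp_sum_abs: "in_Lp p (\<lambda>t. \<Sum>m<n. \<bar>g m t\<bar>)"
  by (intro in_Lp_sum in_Lp_abs Lp p_pos) auto

lemma in_Lp_sqrt_sqsum: "in_Lp p (\<lambda>t. sqrt (sqsum n t))"
proof (rule in_Lp_dominated[OF in_Lp_sum_abs[of n]])
  fix t
  have "sqrt (sqsum n t) \<le> (\<Sum>m<n. \<bar>g m t\<bar>)"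
    using L2_set_le_sum_abs[of "\<lambda>m. g m t" "{..<n}"] by (simp add: L2_set_def sqsum_def)
  then show "\<bar>sqrt (sqsum n t)\<bar> \<le> \<bar>\<Sum>m<n. \<bar>g m t\<bar>\<bar>"
    using sqsum_nonneg[of n t] by simp
qed measurable

section \<open>Pointwise telescoping inequalities\<close>

lemma psum_power_le:
  assumes M: "\<And>n. n \<le> N \<Longrightarrow> \<bar>psum n t\<bar> \<le> M"
  defines "S \<equiv> sqrt (sqsum (Suc N) t)"
  shows "psum (Suc N) t ^ p \<le> real p * (\<Sum>n\<le>N. g n t * psum n t ^ (p - 1))
           + real p * (real p - 1) * (S\<^sup>2 * (M + S) ^ (p - 2))"
proof -
  have p1: "real p \<ge> 1" using p_pos by simp
  have step: "psum (Suc n) t ^ p - psum n t ^ p \<le> real p * (g n t * psum n t ^ (p - 1))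
      + real p * (real p - 1) * ((g n t)\<^sup>2 * (M + S) ^ (p - 2))" if "n \<le> N" for n
  proof -
    have S: "\<bar>g n t\<bar> \<le> S" unfolding S_def using that by (intro abs_le_sqrt_sqsum) auto
    \<comment> \<open>\<open>M\<close> controls the partial sums only up to index N, whereas the
      last increment ends at \<open>psum (Suc N)\<close>. Adding \<open>S\<close>, which dominates
      each single g_n, covers both endpoints.\<close>
    have "\<bar>psum n t\<bar> \<le> M + S" "\<bar>psum n t + g n t\<bar> \<le> M + S"
      using M[OF that] S by linarith+
    from power_taylor_bound[OF this, of p] show ?thesis
      by (simp add: psum_Suc algebra_simps)
  qed
  have "psum (Suc N) t ^ p = (\<Sum>n\<le>N. psum (Suc n) t ^ p - psum n t ^ p)"
    using sum_lessThan_telescope[of "\<lambda>n. psum n t ^ p" "Suc N"] p_pos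
    by (simp add: lessThan_Suc_atMost psum_def)
  also have "\<dots> \<le> (\<Sum>n\<le>N. real p * (g n t * psum n t ^ (p - 1))
      + real p * (real p - 1) * ((g n t)\<^sup>2 * (M + S) ^ (p - 2)))"
    by (intro sum_mono step) auto
  also have "\<dots> = real p * (\<Sum>n\<le>N. g n t * psum n t ^ (p - 1))
      + real p * (real p - 1) * ((\<Sum>n\<le>N. (g n t)\<^sup>2) * (M + S) ^ (p - 2))"
    by (simp add: sum.distrib sum_distrib_left sum_distrib_right)
  also have "(\<Sum>n\<le>N. (g n t)\<^sup>2) = S\<^sup>2"
    unfolding S_def using sqsum_nonneg[of "Suc N" t]
    by (simp add: sqsum_def lessThan_Suc_atMost)
  finally show ?thesis .
qed

text \<open>Summation by parts, done as an induction: the weights are nondecreasing in n and the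
  squares are nonnegative, so each boundary term may be moved to the next larger weight.\<close>

lemma sqsum_abel_le:
  "(\<Sum>n\<le>N. ((psum (Suc n) t)\<^sup>2 - (psum n t)\<^sup>2) * sqsum n t ^ (r - 1))
     \<le> (psum (Suc N) t)\<^sup>2 * sqsum (Suc N) t ^ (r - 1)"
proof -
  have *: "(psum n t)\<^sup>2 * sqsum m t ^ (r - 1) \<le> (psum n t)\<^sup>2 * sqsum (Suc m) t ^ (r - 1)" for n m
    by (intro mult_left_mono power_mono sqsum_mono sqsum_nonneg) auto
  show ?thesis
  proof (induction N)
    case 0
    show ?case using *[of 1 0] by (simp add: psum_def)
  next
    case (Suc N)
    then show ?case using *[of "Suc (Suc N)" "Suc N"] by (simp add: algebra_simps)
  qed
qed

text \<open>The expansion is that of the r-th power of \<open>sqsum\<close>, with increment g_n^2.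
  This keeps all terms polynomial, so that the linear term still meets superorthogonality.\<close>

lemma sqsum_power_le:
  assumes D: "\<And>n. n \<le> N \<Longrightarrow> \<bar>g n t\<bar> \<le> D"
  defines "S \<equiv> sqrt (sqsum (Suc N) t)"
  shows "S ^ p + 2 * real r * (\<Sum>n\<le>N. g n t * (psum n t * sqsum n t ^ (r - 1)))
    \<le> real r * ((psum (Suc N) t)\<^sup>2 * S ^ (p - 2)) + real r * (real r - 1) * (D\<^sup>2 * S ^ (p - 2))"
proof -
  define T where "T = sqsum (Suc N) t"
  have T0: "T \<ge> 0" by (simp add: T_def sqsum_nonneg)
  have r1: "real r \<ge> 1" using r by simp
  have SP: "S ^ (p - 2) = T ^ (r - 1)"
    using power_mult[of S 2 "r - 1"] T0 by (simp add: S_def T_def[symmetric] p diff_mult_distrib2)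
  have step: "sqsum (Suc n) t ^ r - sqsum n t ^ r \<le> real r * ((g n t)\<^sup>2 * sqsum n t ^ (r - 1))
      + real r * (real r - 1) * (D\<^sup>2 * T ^ (r - 2) * (g n t)\<^sup>2)" if "n \<le> N" for n
  proof -
    have le: "\<bar>sqsum n t\<bar> \<le> T" "\<bar>sqsum n t + (g n t)\<^sup>2\<bar> \<le> T"
      using sqsum_mono[of n "Suc N" t] sqsum_mono[of "Suc n" "Suc N" t]
        sqsum_nonneg[of n t] that by (auto simp: T_def sqsum_Suc)
    have "(g n t)\<^sup>2 \<le> D\<^sup>2" using D[OF that] by (metis abs_ge_zero power2_abs power_mono)
    \<comment> \<open>The remainder contains g_n^4. One factor g_n^2 is bounded by D^2, and the
      other is kept so that summation over n restores a power of \<open>T\<close>.\<close>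
    then have "((g n t)\<^sup>2)\<^sup>2 * T ^ (r - 2) \<le> D\<^sup>2 * T ^ (r - 2) * (g n t)\<^sup>2"
      using T0 mult_right_mono[of "(g n t)\<^sup>2" "D\<^sup>2" "T ^ (r - 2) * (g n t)\<^sup>2"]
      by (simp add: power2_eq_square[of "(g n t)\<^sup>2"] mult_ac)
    then have "real r * (real r - 1) * (((g n t)\<^sup>2)\<^sup>2 * T ^ (r - 2))
        \<le> real r * (real r - 1) * (D\<^sup>2 * T ^ (r - 2) * (g n t)\<^sup>2)"
      using r1 by (intro mult_left_mono) auto
    with power_taylor_bound[OF le, of r] show ?thesis
      by (simp add: sqsum_Suc mult.assoc)
  qed
  have "S ^ p = (\<Sum>n\<le>N. sqsum (Suc n) t ^ r - sqsum n t ^ r)"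
    using sum_lessThan_telescope[of "\<lambda>n. sqsum n t ^ r" "Suc N"] r
    by (simp add: lessThan_Suc_atMost S_def sqrt_sqsum_power) (simp add: sqsum_def)
  also have "\<dots> \<le> (\<Sum>n\<le>N. real r * ((g n t)\<^sup>2 * sqsum n t ^ (r - 1))
      + real r * (real r - 1) * (D\<^sup>2 * T ^ (r - 2) * (g n t)\<^sup>2))"
    by (intro sum_mono step) auto
  also have "\<dots> = real r * (\<Sum>n\<le>N. (g n t)\<^sup>2 * sqsum n t ^ (r - 1))
      + real r * (real r - 1) * (D\<^sup>2 * T ^ (r - 2) * (\<Sum>n\<le>N. (g n t)\<^sup>2))"
    by (simp add: sum.distrib sum_distrib_left)
  also have "(\<Sum>n\<le>N. (g n t)\<^sup>2) = T"
    by (simp add: T_def sqsum_def lessThan_Suc_atMost)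
  \<comment> \<open>For \<open>r = 1\<close> the truncated exponent is wrong, but then the coefficient \<open>r - 1\<close> vanishes.\<close>
  also have "real r * (real r - 1) * (D\<^sup>2 * T ^ (r - 2) * T)
      = real r * (real r - 1) * (D\<^sup>2 * T ^ (r - 1))"
  proof (cases "r = 1")
    case False
    then have "r - 1 = Suc (r - 2)" using r by simp
    then show ?thesis by simp
  qed simp
  also have "(\<Sum>n\<le>N. (g n t)\<^sup>2 * sqsum n t ^ (r - 1))
      = (\<Sum>n\<le>N. ((psum (Suc n) t)\<^sup>2 - (psum n t)\<^sup>2) * sqsum n t ^ (r - 1))
        - 2 * (\<Sum>n\<le>N. g n t * (psum n t * sqsum n t ^ (r - 1)))"
    unfolding sum_distrib_left sum_subtractf[symmetric]
    by (intro sum.cong) (simp_all add: psum_Suc power2_eq_square algebra_simps)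
  finally have "S ^ p + 2 * real r * (\<Sum>n\<le>N. g n t * (psum n t * sqsum n t ^ (r - 1)))
      \<le> real r * (\<Sum>n\<le>N. ((psum (Suc n) t)\<^sup>2 - (psum n t)\<^sup>2) * sqsum n t ^ (r - 1))
        + real r * (real r - 1) * (D\<^sup>2 * T ^ (r - 1))"
    by (simp add: algebra_simps)
  also have "\<dots> \<le> real r * ((psum (Suc N) t)\<^sup>2 * T ^ (r - 1))
        + real r * (real r - 1) * (D\<^sup>2 * T ^ (r - 1))"
    unfolding T_def by (intro add_right_mono mult_left_mono sqsum_abel_le) simp
  finally show ?thesis by (simp add: SP)
qed

section \<open>Integration and absorption\<close>

lemma integrable_power:
  assumes "in_Lp p f"
  shows "integrable unit_leb (\<lambda>t. f t ^ p)"
  using assms by (simp add: in_Lp_def abs_power_p)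

text \<open>Here \<open>M\<close> is any L^p majorant of the partial sums whose p-th power integral
  is controlled by that of G_N. Its contribution is absorbed into the left side, so \<epsilon> must
  be small in terms of \<open>a\<close>.\<close>

lemma integral_psum_le:
  assumes M: "in_Lp p M" "\<And>n t. n \<le> N \<Longrightarrow> \<bar>psum n t\<bar> \<le> M t"
    and A: "(LINT t|unit_leb. \<bar>M t\<bar> ^ p) \<le> a * (LINT t|unit_leb. \<bar>psum (Suc N) t\<bar> ^ p)"
    and \<epsilon>: "0 < \<epsilon>" "\<epsilon> \<le> 1" "2 * (real p * (real p - 1) * \<epsilon> * 2 ^ p * a) \<le> 1"
  shows "(LINT t|unit_leb. \<bar>psum (Suc N) t\<bar> ^ p)
    \<le> 2 * (real p * (real p - 1) * (\<epsilon> * 2 ^ p + (1 / \<epsilon>) ^ p))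
      * (LINT t|unit_leb. \<bar>sqrt (sqsum (Suc N) t)\<bar> ^ p)"
proof -
  define S where "S t = sqrt (sqsum (Suc N) t)" for t
  define c where "c = real p * (real p - 1)"
  define Z where "Z t = (\<Sum>n\<le>N. g n t * psum n t ^ (p - 1))" for t
  have c0: "c \<ge> 0" using p_pos by (simp add: c_def)
  have S0: "S t \<ge> 0" for t by (simp add: S_def sqsum_nonneg)
  have M0: "M t \<ge> 0" for t using M(2)[of 0 t] by (auto intro: order_trans[OF abs_ge_zero])
  have intZ: "integrable unit_leb Z" and Z: "(LINT t|unit_leb. Z t) = 0"
    unfolding Z_def
    using homogeneous_poly_orthogonal[OF homogeneous_poly_psum_power] by auto
  have intS: "integrable unit_leb (\<lambda>t. S t ^ p)"
    unfolding S_def by (intro integrable_power in_Lp_sqrt_sqsum)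
  have intM: "integrable unit_leb (\<lambda>t. M t ^ p)"
    by (intro integrable_power M)
  have intG: "integrable unit_leb (\<lambda>t. psum (Suc N) t ^ p)"
    by (intro integrable_power in_Lp_psum)
  have pw: "psum (Suc N) t ^ p
      \<le> real p * Z t + (c * \<epsilon> * 2 ^ p * M t ^ p + c * (\<epsilon> * 2 ^ p + (1 / \<epsilon>) ^ p) * S t ^ p)" for t
  proof -
    \<comment> \<open>Young's inequality with j = 2, the small factor being placed on M + S.\<close>
    have "(S t)\<^sup>2 * (M t + S t) ^ (p - 2) \<le> \<epsilon> * (M t + S t) ^ p + (1 / \<epsilon>) ^ p * S t ^ p"
      using \<epsilon> r p S0 M0 by (intro young_power) (auto intro: add_nonneg_nonneg)
    also have "\<dots> \<le> \<epsilon> * (2 ^ p * (M t ^ p + S t ^ p)) + (1 / \<epsilon>) ^ p * S t ^ p"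
      using \<epsilon> S0 M0 by (intro add_right_mono mult_left_mono power_add_le) auto
    finally have "c * ((S t)\<^sup>2 * (M t + S t) ^ (p - 2))
        \<le> c * (\<epsilon> * (2 ^ p * (M t ^ p + S t ^ p)) + (1 / \<epsilon>) ^ p * S t ^ p)"
      using c0 by (rule mult_left_mono)
    also have "\<dots> = c * \<epsilon> * 2 ^ p * M t ^ p + c * (\<epsilon> * 2 ^ p + (1 / \<epsilon>) ^ p) * S t ^ p"
      by (simp add: algebra_simps)
    finally show ?thesis
      using psum_power_le[of N t "M t", OF M(2)] unfolding Z_def S_def c_def by linarith
  qed
  have "(LINT t|unit_leb. psum (Suc N) t ^ p)
      \<le> (LINT t|unit_leb. real p * Z t
          + (c * \<epsilon> * 2 ^ p * M t ^ p + c * (\<epsilon> * 2 ^ p + (1 / \<epsilon>) ^ p) * S t ^ p))"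
    using pw by (intro integral_mono Bochner_Integration.integrable_add
        integrable_mult_right intG intZ intM intS)
  also have "\<dots> = c * \<epsilon> * 2 ^ p * (LINT t|unit_leb. M t ^ p)
      + c * (\<epsilon> * 2 ^ p + (1 / \<epsilon>) ^ p) * (LINT t|unit_leb. S t ^ p)"
    by (simp add: intZ intM intS Z)
  also have "c * \<epsilon> * 2 ^ p * (LINT t|unit_leb. M t ^ p)
      \<le> c * \<epsilon> * 2 ^ p * (a * (LINT t|unit_leb. psum (Suc N) t ^ p))"
    using A c0 \<epsilon> by (intro mult_left_mono) (auto simp: abs_power_p)
  also have "\<dots> = (c * \<epsilon> * 2 ^ p * a) * (LINT t|unit_leb. psum (Suc N) t ^ p)"
    by simp
  \<comment> \<open>The smallness condition on \<epsilon> leaves at most half of the left side;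
    moving it over produces the factor 2 in the conclusion.\<close>
  also have "\<dots> \<le> 1 / 2 * (LINT t|unit_leb. psum (Suc N) t ^ p)"
    using \<epsilon>(3) p_even by (intro mult_right_mono integral_nonneg_AE) (auto simp: c_def)
  finally show ?thesis
    by (simp add: abs_power_p c_def S_def algebra_simps)
qed

text \<open>Now the square function is absorbed into itself, so \<epsilon> depends on r alone. The
  term with D receives the large factor (1 / \<epsilon>)^p, which is harmless because it is bounded
  by the integral of G_N^p; thus \<open>b\<close> enters only the final constant.\<close>

lemma integral_sqsum_le:
  assumes D: "in_Lp p D" "\<And>n t. n \<le> N \<Longrightarrow> \<bar>g n t\<bar> \<le> D t"
    and B: "(LINT t|unit_leb. \<bar>D t\<bar> ^ p) \<le> b * (LINT t|unit_leb. \<bar>psum (Suc N) t\<bar> ^ p)"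
    and \<epsilon>: "0 < \<epsilon>" "\<epsilon> \<le> 1" "4 * (real r)\<^sup>2 * \<epsilon> \<le> 1"
  shows "(LINT t|unit_leb. \<bar>sqrt (sqsum (Suc N) t)\<bar> ^ p)
    \<le> 2 * ((real r)\<^sup>2 * (1 / \<epsilon>) ^ p * (1 + b)) * (LINT t|unit_leb. \<bar>psum (Suc N) t\<bar> ^ p)"
proof -
  define S where "S t = sqrt (sqsum (Suc N) t)" for t
  define G where "G t = psum (Suc N) t" for t
  define c where "c = (real r)\<^sup>2"
  define e where "e = (1 / \<epsilon>) ^ p"
  define W where "W t = (\<Sum>n\<le>N. g n t * (psum n t * sqsum n t ^ (r - 1)))" for t
  have c0: "c \<ge> 0" by (simp add: c_def)
  \<comment> \<open>Both coefficients from the pointwise inequality are replaced by r^2. The two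
    applications of Young's inequality then cost 2 r^2 \<epsilon>, at most 1/2 by
    assumption.\<close>
  have rc: "real r \<le> c" "real r * (real r - 1) \<le> c"
    using r by (auto simp: c_def power2_eq_square algebra_simps)
  have S0: "S t \<ge> 0" for t by (simp add: S_def sqsum_nonneg)
  have D0: "D t \<ge> 0" for t using D(2)[of 0 t] by (auto intro: order_trans[OF abs_ge_zero])
  have intW: "integrable unit_leb W" and W: "(LINT t|unit_leb. W t) = 0"
    unfolding W_def
    using homogeneous_poly_orthogonal[OF homogeneous_poly_psum_sqsum] by auto
  have intS: "integrable unit_leb (\<lambda>t. S t ^ p)"
    unfolding S_def by (intro integrable_power in_Lp_sqrt_sqsum)
  have intD: "integrable unit_leb (\<lambda>t. D t ^ p)"
    by (intro integrable_power D)
  have intG: "integrable unit_leb (\<lambda>t. G t ^ p)"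
    unfolding G_def by (intro integrable_power in_Lp_psum)
  have young: "x\<^sup>2 * S t ^ (p - 2) \<le> \<epsilon> * S t ^ p + e * x ^ p" for x t
    using young_power[of \<epsilon> "\<bar>x\<bar>" "S t" 2 p] \<epsilon> r p S0 abs_power_p[of x] by (simp add: e_def)
  have pw: "S t ^ p \<le> 2 * c * \<epsilon> * S t ^ p + c * e * (G t ^ p + D t ^ p) - 2 * real r * W t" for t
  proof -
    have "real r * ((G t)\<^sup>2 * S t ^ (p - 2)) \<le> c * ((G t)\<^sup>2 * S t ^ (p - 2))"
      using rc S0 by (intro mult_right_mono) auto
    also have "\<dots> \<le> c * (\<epsilon> * S t ^ p + e * G t ^ p)"
      using c0 young by (intro mult_left_mono)
    finally have 1: "real r * ((G t)\<^sup>2 * S t ^ (p - 2)) \<le> c * (\<epsilon> * S t ^ p + e * G t ^ p)" .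
    have "real r * (real r - 1) * ((D t)\<^sup>2 * S t ^ (p - 2)) \<le> c * ((D t)\<^sup>2 * S t ^ (p - 2))"
      using rc S0 by (intro mult_right_mono) auto
    also have "\<dots> \<le> c * (\<epsilon> * S t ^ p + e * D t ^ p)"
      using c0 young by (intro mult_left_mono)
    finally have "S t ^ p + 2 * real r * W t
        \<le> c * (\<epsilon> * S t ^ p + e * G t ^ p) + c * (\<epsilon> * S t ^ p + e * D t ^ p)"
      using 1 sqsum_power_le[of N t "D t", OF D(2)]
      unfolding W_def S_def G_def by linarith
    then show ?thesis by (simp add: algebra_simps)
  qed
  have "(LINT t|unit_leb. S t ^ p) \<le> (LINT t|unit_leb.
      2 * c * \<epsilon> * S t ^ p + c * e * (G t ^ p + D t ^ p) - 2 * real r * W t)"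
    using pw by (intro integral_mono Bochner_Integration.integrable_add
        Bochner_Integration.integrable_diff integrable_mult_right intG intW intD intS)
  also have "\<dots> = 2 * c * \<epsilon> * (LINT t|unit_leb. S t ^ p)
      + c * e * ((LINT t|unit_leb. G t ^ p) + (LINT t|unit_leb. D t ^ p))"
    by (simp add: intG intW intD intS W)
  also have "2 * c * \<epsilon> * (LINT t|unit_leb. S t ^ p) \<le> 1 / 2 * (LINT t|unit_leb. S t ^ p)"
    using \<epsilon>(3) S0 by (intro mult_right_mono integral_nonneg_AE) (auto simp: c_def)
  also have "c * e * ((LINT t|unit_leb. G t ^ p) + (LINT t|unit_leb. D t ^ p))
      \<le> c * e * ((LINT t|unit_leb. G t ^ p) + b * (LINT t|unit_leb. G t ^ p))"
    using B c0 \<epsilon> by (intro mult_left_mono add_left_mono) (auto simp: e_def G_def abs_power_p)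
  finally show ?thesis
    by (simp add: abs_power_p c_def S_def e_def G_def algebra_simps)
qed

section \<open>The two majorants supplied by hypotheses (2) and (3)\<close>

text \<open>Membership in L^p ensures that the norm in (2) is a genuine one and not the default
  value 0 of a divergent integral.\<close>

lemma Sup_abs_psum:
  fixes N :: nat
  defines "M \<equiv> \<lambda>t. SUP n\<in>{0..N}. \<bar>psum n t\<bar>"
  shows "in_Lp p M" and "n \<le> N \<Longrightarrow> \<bar>psum n t\<bar> \<le> M t"
proof -
  show upper: "\<bar>psum n t\<bar> \<le> M t" if "n \<le> N" for n t
    unfolding M_def using that by (intro cSUP_upper) auto
  show "in_Lp p M"
  proof (rule in_Lp_dominated[OF in_Lp_sum_abs[of "Suc N"]])
    show "M \<in> borel_measurable unit_leb"
      unfolding M_def by (intro borel_measurable_cSUP) auto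
    fix t
    have "\<bar>psum n t\<bar> \<le> (\<Sum>m<Suc N. \<bar>g m t\<bar>)" if "n \<le> N" for n
    proof -
      have "\<bar>psum n t\<bar> \<le> (\<Sum>m<n. \<bar>g m t\<bar>)"
        unfolding psum_def by (rule sum_abs)
      also have "\<dots> \<le> (\<Sum>m<Suc N. \<bar>g m t\<bar>)"
        using that by (intro sum_mono2) auto
      finally show ?thesis .
    qed
    then have "M t \<le> (\<Sum>m<Suc N. \<bar>g m t\<bar>)"
      unfolding M_def by (intro cSUP_least) auto
    moreover have "0 \<le> M t"
      using upper[of 0 t] by (auto intro: order_trans[OF abs_ge_zero])
    ultimately show "\<bar>M t\<bar> \<le> \<bar>\<Sum>m<Suc N. \<bar>g m t\<bar>\<bar>" by simp
  qed
qed

text \<open>Since p is even, all summands are nonnegative: the p-th power of the root is the sum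
  itself, a finite sum of integrable functions, and each summand is below the total.\<close>

lemma root_sum_power:
  fixes N :: nat
  defines "D \<equiv> \<lambda>t. root p (\<Sum>n=0..N. g n t ^ p)"
  shows "in_Lp p D" and "n \<le> N \<Longrightarrow> \<bar>g n t\<bar> \<le> D t"
proof -
  have nonneg: "0 \<le> (\<Sum>n=0..N. g n t ^ p)" for t
    using p_even by (intro sum_nonneg) auto
  have "D t ^ p = (\<Sum>n=0..N. g n t ^ p)" for t
    unfolding D_def using p_pos nonneg by (rule real_root_pow_pos2)
  moreover have "integrable unit_leb (\<lambda>t. \<Sum>n=0..N. g n t ^ p)"
    by (intro Bochner_Integration.integrable_sum integrable_power Lp)
  moreover have "D \<in> borel_measurable unit_leb"
    unfolding D_def by measurable
  ultimately show "in_Lp p D"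
    by (simp add: in_Lp_def abs_power_p)
  show "\<bar>g n t\<bar> \<le> D t" if "n \<le> N" for n t
  proof -
    have "\<bar>g n t\<bar> = root p (g n t ^ p)"
      using real_root_power_cancel[OF p_pos, of "\<bar>g n t\<bar>"] by (simp add: abs_power_p)
    also have "\<dots> \<le> D t"
      unfolding D_def using that p_even p_pos
      by (intro real_root_le_mono member_le_sum[of n _ "\<lambda>n. g n t ^ p"]) auto
    finally show ?thesis .
  qed
qed

end

section \<open>Return to the original sequences and choice of constants\<close>

text \<open>Telescoping from the value 0 at index -1, which is the case n = 0.\<close>

lemma partial_G_conv_sum: "partial_G \<mu> c \<alpha> (int n - 1) t = (\<Sum>m<n. diff_g \<mu> c \<alpha> m t)"
proof (induction n)
  case 0
  then show ?case by (simp add: partial_G_def)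
next
  case (Suc n)
  then show ?case by (simp add: diff_g_def)
qed

lemma in_Lp_partial_G:
  assumes "p > 0" "\<And>m. in_Lp p (\<mu> m)"
  shows "in_Lp p (partial_G \<mu> c \<alpha> n)"
  unfolding partial_G_def[abs_def] using assms
  by (cases "n < 0") (auto intro!: in_Lp_zero in_Lp_sum in_Lp_cmult)

lemma in_Lp_diff_g:
  assumes "p > 0" "\<And>m. in_Lp p (\<mu> m)"
  shows "in_Lp p (diff_g \<mu> c \<alpha> n)"
  using in_Lp_add[OF in_Lp_partial_G in_Lp_cmult[OF in_Lp_partial_G, where c = "-1"], OF assms assms]
  by (simp add: diff_g_def[abs_def])

theorem mainTheorem3:
  fixes p r :: nat and A B :: real
  assumes "r \<ge> 1" and "p = 2 * r"
  shows "\<exists>C C' :: real. C' > 0 \<and>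
    (\<forall>(\<mu> :: nat \<Rightarrow> real \<Rightarrow> real) (c :: nat \<Rightarrow> real) (\<alpha> :: nat \<Rightarrow> nat).
      (\<forall>m. in_Lp p (\<mu> m)) \<longrightarrow>
      strict_mono \<alpha> \<longrightarrow>
      superorthogonal_III r (diff_g \<mu> c \<alpha>) \<longrightarrow>
      (\<forall>N :: nat. Lp_norm p (\<lambda>t. SUP n\<in>{0..N}. \<bar>partial_G \<mu> c \<alpha> (int n - 1) t\<bar>)
                    \<le> A * Lp_norm p (partial_G \<mu> c \<alpha> (int N))) \<longrightarrow>
      (\<forall>N :: nat. Lp_norm p (\<lambda>t. root p (\<Sum>n=0..N. diff_g \<mu> c \<alpha> n t ^ p))
                    \<le> B * Lp_norm p (partial_G \<mu> c \<alpha> (int N))) \<longrightarrow>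
      (\<forall>N :: nat.
        C' * Lp_norm p (\<lambda>t. sqrt (\<Sum>n=0..N. (diff_g \<mu> c \<alpha> n t)\<^sup>2))
          \<le> Lp_norm p (\<lambda>t. \<Sum>n=0..N. diff_g \<mu> c \<alpha> n t) \<and>
        Lp_norm p (\<lambda>t. \<Sum>n=0..N. diff_g \<mu> c \<alpha> n t)
          \<le> C * Lp_norm p (\<lambda>t. sqrt (\<Sum>n=0..N. (diff_g \<mu> c \<alpha> n t)\<^sup>2))))"
proof -
  have p0: "p > 0" and r1: "real r \<ge> 1" and p1: "real p \<ge> 1" using assms by auto
  \<comment> \<open>\<open>d\<close> is the coefficient of \<epsilon> in the absorption condition
    for the upper bound. The shift in 1 / (d + 1) covers d = 0 and keeps \<epsilon> at most
    1.\<close>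
  define d where "d = 2 * (real p * (real p - 1) * 2 ^ p * \<bar>A\<bar> ^ p)"
  have d0: "d \<ge> 0" using p1 by (simp add: d_def)
  define \<epsilon> where "\<epsilon> = 1 / (d + 1)"
  have \<epsilon>: "0 < \<epsilon>" "\<epsilon> \<le> 1" "2 * (real p * (real p - 1) * \<epsilon> * 2 ^ p * \<bar>A\<bar> ^ p) \<le> 1"
  proof -
    have "d * \<epsilon> \<le> 1" using d0 by (simp add: \<epsilon>_def)
    then show "2 * (real p * (real p - 1) * \<epsilon> * 2 ^ p * \<bar>A\<bar> ^ p) \<le> 1"
      by (simp add: d_def mult_ac)
  qed (use d0 in \<open>auto simp: \<epsilon>_def\<close>)
  define \<delta> where "\<delta> = 1 / (4 * (real r)\<^sup>2)"
  have \<delta>: "0 < \<delta>" "\<delta> \<le> 1" "4 * (real r)\<^sup>2 * \<delta> \<le> 1"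
  proof -
    have "1 \<le> (real r)\<^sup>2" using r1 by (rule one_le_power)
    then have "1 \<le> 4 * (real r)\<^sup>2" by linarith
    then show "0 < \<delta>" "\<delta> \<le> 1" "4 * (real r)\<^sup>2 * \<delta> \<le> 1"
      using r1 by (auto simp: \<delta>_def divide_le_eq)
  qed
  \<comment> \<open>The constants of the two integral inequalities. They are fixed before the
    sequences and depend only on p, \<open>A\<close> and \<open>B\<close>, as r = p / 2.\<close>
  define K where "K = 2 * (real p * (real p - 1) * (\<epsilon> * 2 ^ p + (1 / \<epsilon>) ^ p))"
  define L where "L = 2 * ((real r)\<^sup>2 * (1 / \<delta>) ^ p * (1 + \<bar>B\<bar> ^ p))"
  \<comment> \<open>Strict positivity allows division by this root, whose reciprocal is the witness
    for C'.\<close>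
  have L0: "root p L > 0"
    unfolding L_def using r1 \<delta> p0
    by (intro real_root_gt_zero mult_pos_pos add_pos_nonneg) auto
  show ?thesis
  proof (rule exI[of _ "root p K"], rule exI[of _ "1 / root p L"], intro conjI allI impI)
    show "1 / root p L > 0" using L0 by simp
  next
    fix \<mu> :: "nat \<Rightarrow> real \<Rightarrow> real" and c \<alpha> N
    assume \<mu>: "\<forall>m. in_Lp p (\<mu> m)"
      and orth: "superorthogonal_III r (diff_g \<mu> c \<alpha>)"
      and hA: "\<forall>N :: nat. Lp_norm p (\<lambda>t. SUP n\<in>{0..N}. \<bar>partial_G \<mu> c \<alpha> (int n - 1) t\<bar>)
                    \<le> A * Lp_norm p (partial_G \<mu> c \<alpha> (int N))"
      and hB: "\<forall>N :: nat. Lp_norm p (\<lambda>t. root p (\<Sum>n=0..N. diff_g \<mu> c \<alpha> n t ^ p))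
                    \<le> B * Lp_norm p (partial_G \<mu> c \<alpha> (int N))"
    interpret superorthogonal_sequence r p "diff_g \<mu> c \<alpha>"
      using assms orth \<mu> p0 by unfold_locales (auto intro: in_Lp_diff_g)
    have G: "partial_G \<mu> c \<alpha> (int n - 1) = psum n" for n
      by (rule ext) (simp add: partial_G_conv_sum psum_def)
    have G': "partial_G \<mu> c \<alpha> (int N) = psum (Suc N)"
      using G[of "Suc N"] by simp
    have sum: "(\<lambda>t. \<Sum>n=0..N. diff_g \<mu> c \<alpha> n t) = psum (Suc N)"
      "(\<lambda>t. sqrt (\<Sum>n=0..N. (diff_g \<mu> c \<alpha> n t)\<^sup>2)) = (\<lambda>t. sqrt (sqsum (Suc N) t))"
      by (simp_all add: fun_eq_iff psum_def sqsum_def atLeast0AtMost lessThan_Suc_atMost)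
    note A = integral_le_of_Lp_norm_le[OF p0 hA[rule_format, of N, unfolded G G']]
    note B = integral_le_of_Lp_norm_le[OF p0 hB[rule_format, of N, unfolded G']]
    show "Lp_norm p (\<lambda>t. \<Sum>n=0..N. diff_g \<mu> c \<alpha> n t)
        \<le> root p K * Lp_norm p (\<lambda>t. sqrt (\<Sum>n=0..N. (diff_g \<mu> c \<alpha> n t)\<^sup>2))"
      unfolding sum K_def
      by (intro Lp_norm_le_of_integral_le p0 integral_psum_le[OF Sup_abs_psum A \<epsilon>])
    have "Lp_norm p (\<lambda>t. sqrt (\<Sum>n=0..N. (diff_g \<mu> c \<alpha> n t)\<^sup>2))
        \<le> root p L * Lp_norm p (\<lambda>t. \<Sum>n=0..N. diff_g \<mu> c \<alpha> n t)"
      unfolding sum L_def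
      by (intro Lp_norm_le_of_integral_le p0 integral_sqsum_le[OF root_sum_power B \<delta>])
    then show "1 / root p L * Lp_norm p (\<lambda>t. sqrt (\<Sum>n=0..N. (diff_g \<mu> c \<alpha> n t)\<^sup>2))
        \<le> Lp_norm p (\<lambda>t. \<Sum>n=0..N. diff_g \<mu> c \<alpha> n t)"
      using L0 by (simp add: field_simps)
  qed
qed

end
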